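(* Let $n$ be a positive integer and let $a,b$ be integers such that $\gcd(a,n)=\gcd(b,n)=1$. The following hold: (i) If $n$ is odd, then there is a ring isomorphism $$\left(\frac{a,b}{\mathbb{Z}/n\mathbb{Z}}\right)\cong \mathbb{M}_2(\mathbb{Z}/n\mathbb{Z}).$$ (ii) If $n=2^s m$ with $s>0$ and $m$ odd, then there is a ring isomorphism $$\left(\frac{a,b}{\mathbb{Z}/n\mathbb{Z}}\right)\cong \begin{cases}\mathbb{M}_2(\mathbb{Z}/m\mathbb{Z})\times\left(\frac{-1,-1}{\mathbb{Z}/2^s\mathbb{Z}}\right), & \text{if } s=1 \text{ or } a\equiv b\equiv -1 \pmod 4;\\[4pt] \mathbb{M}_2(\mathbb{Z}/m\mathbb{Z})\times\left(\frac{1,1}{\mathbb{Z}/2^s\mathbb{Z}}\right), & \text{otherwise.}\end{cases}$$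
   Context: For a commutative associative ring $R$ with identity and units $a,b\in R$, the quaternion ring $\left(\frac{a,b}{R}\right)$ is the free $R$-module of rank $4$ with basis $\{1,i,j,k\}$, equipped with the associative, unital, $R$-bilinear multiplication determined by $i^2=a$, $j^2=b$, $ij=-ji=k$. For integers $a,b$ coprime to $n$, $\left(\frac{a,b}{\mathbb{Z}/n\mathbb{Z}}\right)$ is formed with the residue classes of $a,b$ modulo $n$. $\mathbb{M}_2(R)$ denotes the ring of $2\times 2$ matrices over $R$. *)

theory Defs
  imports "HOL-Algebra.IntRing" "HOL-Algebra.Chinese_Remainder" "HOL-Number_Theory.Cong"
begin

text \<open>
  The tuple \<open>(x0, x1, x2, x3)\<close> stands for \<open>x0 + x1 i + x2 j + x3 k\<close>. The product is the bilinear
  extension of \<open>i\<^sup>2 = a\<close>, \<open>j\<^sup>2 = b\<close>, \<open>ij = -ji = k\<close>, which by associativity forces \<open>k\<^sup>2 = -ab\<close>,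
  \<open>ik = -ki = aj\<close> and \<open>kj = -jk = bi\<close>.
\<close>

definition quaternion_ring ::
    "('r, 'm) ring_scheme \<Rightarrow> 'r \<Rightarrow> 'r \<Rightarrow> ('r \<times> 'r \<times> 'r \<times> 'r) ring"
  where
  "quaternion_ring R a b =
    \<lparr>carrier = carrier R \<times> carrier R \<times> carrier R \<times> carrier R,
     mult = \<lambda>(x0, x1, x2, x3) (y0, y1, y2, y3).
       (x0 \<otimes>\<^bsub>R\<^esub> y0 \<oplus>\<^bsub>R\<^esub> a \<otimes>\<^bsub>R\<^esub> (x1 \<otimes>\<^bsub>R\<^esub> y1) \<oplus>\<^bsub>R\<^esub> b \<otimes>\<^bsub>R\<^esub> (x2 \<otimes>\<^bsub>R\<^esub> y2) \<ominus>\<^bsub>R\<^esub> (a \<otimes>\<^bsub>R\<^esub> b) \<otimes>\<^bsub>R\<^esub> (x3 \<otimes>\<^bsub>R\<^esub> y3),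
        x0 \<otimes>\<^bsub>R\<^esub> y1 \<oplus>\<^bsub>R\<^esub> x1 \<otimes>\<^bsub>R\<^esub> y0 \<ominus>\<^bsub>R\<^esub> b \<otimes>\<^bsub>R\<^esub> (x2 \<otimes>\<^bsub>R\<^esub> y3) \<oplus>\<^bsub>R\<^esub> b \<otimes>\<^bsub>R\<^esub> (x3 \<otimes>\<^bsub>R\<^esub> y2),
        x0 \<otimes>\<^bsub>R\<^esub> y2 \<oplus>\<^bsub>R\<^esub> x2 \<otimes>\<^bsub>R\<^esub> y0 \<oplus>\<^bsub>R\<^esub> a \<otimes>\<^bsub>R\<^esub> (x1 \<otimes>\<^bsub>R\<^esub> y3) \<ominus>\<^bsub>R\<^esub> a \<otimes>\<^bsub>R\<^esub> (x3 \<otimes>\<^bsub>R\<^esub> y1),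
        x0 \<otimes>\<^bsub>R\<^esub> y3 \<oplus>\<^bsub>R\<^esub> x3 \<otimes>\<^bsub>R\<^esub> y0 \<oplus>\<^bsub>R\<^esub> x1 \<otimes>\<^bsub>R\<^esub> y2 \<ominus>\<^bsub>R\<^esub> x2 \<otimes>\<^bsub>R\<^esub> y1),
     one = (\<one>\<^bsub>R\<^esub>, \<zero>\<^bsub>R\<^esub>, \<zero>\<^bsub>R\<^esub>, \<zero>\<^bsub>R\<^esub>),
     zero = (\<zero>\<^bsub>R\<^esub>, \<zero>\<^bsub>R\<^esub>, \<zero>\<^bsub>R\<^esub>, \<zero>\<^bsub>R\<^esub>),
     add = \<lambda>(x0, x1, x2, x3) (y0, y1, y2, y3).
       (x0 \<oplus>\<^bsub>R\<^esub> y0, x1 \<oplus>\<^bsub>R\<^esub> y1, x2 \<oplus>\<^bsub>R\<^esub> y2, x3 \<oplus>\<^bsub>R\<^esub> y3)\<rparr>"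

text \<open>The tuple \<open>(p, q, r, s)\<close> stands for the matrix with rows \<open>(p, q)\<close> and \<open>(r, s)\<close>.\<close>

definition mat2_ring :: "('r, 'm) ring_scheme \<Rightarrow> ('r \<times> 'r \<times> 'r \<times> 'r) ring"
  where
  "mat2_ring R =
    \<lparr>carrier = carrier R \<times> carrier R \<times> carrier R \<times> carrier R,
     mult = \<lambda>(p, q, r, s) (p', q', r', s').
       (p \<otimes>\<^bsub>R\<^esub> p' \<oplus>\<^bsub>R\<^esub> q \<otimes>\<^bsub>R\<^esub> r', p \<otimes>\<^bsub>R\<^esub> q' \<oplus>\<^bsub>R\<^esub> q \<otimes>\<^bsub>R\<^esub> s',
        r \<otimes>\<^bsub>R\<^esub> p' \<oplus>\<^bsub>R\<^esub> s \<otimes>\<^bsub>R\<^esub> r', r \<otimes>\<^bsub>R\<^esub> q' \<oplus>\<^bsub>R\<^esub> s \<otimes>\<^bsub>R\<^esub> s'),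
     one = (\<one>\<^bsub>R\<^esub>, \<zero>\<^bsub>R\<^esub>, \<zero>\<^bsub>R\<^esub>, \<one>\<^bsub>R\<^esub>),
     zero = (\<zero>\<^bsub>R\<^esub>, \<zero>\<^bsub>R\<^esub>, \<zero>\<^bsub>R\<^esub>, \<zero>\<^bsub>R\<^esub>),
     add = \<lambda>(p, q, r, s) (p', q', r', s').
       (p \<oplus>\<^bsub>R\<^esub> p', q \<oplus>\<^bsub>R\<^esub> q', r \<oplus>\<^bsub>R\<^esub> r', s \<oplus>\<^bsub>R\<^esub> s')\<rparr>"

text \<open>
  \<open>\<int>/n\<int>\<close> is \<^const>\<open>ZFact\<close> rather than \<open>residue_ring\<close>, since the latter is not a ring for \<open>n = 1\<close>
  (its unit is the integer \<open>1\<close>, which is outside its carrier \<open>{0}\<close>).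
\<close>

definition residue_class :: "nat \<Rightarrow> int \<Rightarrow> int set"
  where "residue_class n a = Idl\<^bsub>\<Z>\<^esub> {int n} +>\<^bsub>\<Z>\<^esub> a"

definition quaternion_mod :: "nat \<Rightarrow> int \<Rightarrow> int \<Rightarrow> (int set \<times> int set \<times> int set \<times> int set) ring"
  where "quaternion_mod n a b = quaternion_ring (ZFact (int n)) (residue_class n a) (residue_class n b)"

definition mat2_mod :: "nat \<Rightarrow> (int set \<times> int set \<times> int set \<times> int set) ring"
  where "mat2_mod n = mat2_ring (ZFact (int n))"

lemma residue_class_closed: "residue_class n a \<in> carrier (ZFact (int n))"
  by (auto simp: residue_class_def ZFact_defs A_RCOSETS_def' a_r_coset_def')

lemma residue_class_eq: "residue_class n a = {y. [y = a] (mod int n)}"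
proof -
  have "residue_class n a = {y. \<exists>k. y = k * int n + a}"
    by (auto simp: residue_class_def a_r_coset_def' int.cgenideal_eq_genideal[symmetric]
        cgenideal_def)
  moreover have "[y = a] (mod int n) \<longleftrightarrow> (\<exists>k. y = k * int n + a)" for y
    unfolding cong_iff_dvd_diff dvd_def by (simp add: diff_eq_eq mult.commute)
  ultimately show ?thesis
    by simp
qed

lemma (in cring) quaternion_ring_basis_mult:
  assumes "a \<in> carrier R" "b \<in> carrier R"
  defines "Q \<equiv> quaternion_ring R a b"
    and "i \<equiv> (\<zero>, \<one>, \<zero>, \<zero>)" and "j \<equiv> (\<zero>, \<zero>, \<one>, \<zero>)" and "k \<equiv> (\<zero>, \<zero>, \<zero>, \<one>)"
  shows "i \<otimes>\<^bsub>Q\<^esub> i = (a, \<zero>, \<zero>, \<zero>)" "j \<otimes>\<^bsub>Q\<^esub> j = (b, \<zero>, \<zero>, \<zero>)"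
    "k \<otimes>\<^bsub>Q\<^esub> k = (\<ominus> (a \<otimes> b), \<zero>, \<zero>, \<zero>)"
    "i \<otimes>\<^bsub>Q\<^esub> j = k" "j \<otimes>\<^bsub>Q\<^esub> i = (\<zero>, \<zero>, \<zero>, \<ominus> \<one>)"
    "i \<otimes>\<^bsub>Q\<^esub> k = (\<zero>, \<zero>, a, \<zero>)" "k \<otimes>\<^bsub>Q\<^esub> i = (\<zero>, \<zero>, \<ominus> a, \<zero>)"
    "k \<otimes>\<^bsub>Q\<^esub> j = (\<zero>, b, \<zero>, \<zero>)" "j \<otimes>\<^bsub>Q\<^esub> k = (\<zero>, \<ominus> b, \<zero>, \<zero>)"
  using assms(1,2) by (simp_all add: Q_def i_def j_def k_def quaternion_ring_def a_minus_def)

lemma (in cring) quaternion_ring_is_ring: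
  assumes [simp]: "a \<in> carrier R" "b \<in> carrier R"
  shows "ring (quaternion_ring R a b)" (is "ring ?Q")
proof -
  note simps = a_minus_def l_distr r_distr l_minus r_minus minus_add a_ac m_ac
  show ?thesis
  proof (rule ringI)
    show "abelian_group ?Q"
    proof (rule abelian_groupI)
      fix x assume "x \<in> carrier ?Q"
      then obtain p q r s where "x = (p, q, r, s)"
        and "p \<in> carrier R" "q \<in> carrier R" "r \<in> carrier R" "s \<in> carrier R"
        by (auto simp: quaternion_ring_def)
      then show "\<exists>y\<in>carrier ?Q. y \<oplus>\<^bsub>?Q\<^esub> x = \<zero>\<^bsub>?Q\<^esub>"
        by (intro bexI[of _ "(\<ominus> p, \<ominus> q, \<ominus> r, \<ominus> s)"]) (auto simp: quaternion_ring_def l_neg)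
    qed (auto simp: quaternion_ring_def a_ac)
    show "Group.monoid ?Q"
    proof (rule monoidI)
      fix x y z assume "x \<in> carrier ?Q" "y \<in> carrier ?Q" "z \<in> carrier ?Q"
      then show "x \<otimes>\<^bsub>?Q\<^esub> y \<otimes>\<^bsub>?Q\<^esub> z = x \<otimes>\<^bsub>?Q\<^esub> (y \<otimes>\<^bsub>?Q\<^esub> z)"
        by (clarsimp simp: quaternion_ring_def, intro conjI; simp add: simps)
    qed (auto simp: quaternion_ring_def a_minus_def)
    fix x y z assume "x \<in> carrier ?Q" "y \<in> carrier ?Q" "z \<in> carrier ?Q"
    then show "(x \<oplus>\<^bsub>?Q\<^esub> y) \<otimes>\<^bsub>?Q\<^esub> z = x \<otimes>\<^bsub>?Q\<^esub> z \<oplus>\<^bsub>?Q\<^esub> y \<otimes>\<^bsub>?Q\<^esub> z"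
      "z \<otimes>\<^bsub>?Q\<^esub> (x \<oplus>\<^bsub>?Q\<^esub> y) = z \<otimes>\<^bsub>?Q\<^esub> x \<oplus>\<^bsub>?Q\<^esub> z \<otimes>\<^bsub>?Q\<^esub> y"
      by (clarsimp simp: quaternion_ring_def, intro conjI; simp add: simps)+
  qed
qed

lemma (in ring) mat2_ring_is_ring: "ring (mat2_ring R)" (is "ring ?M")
proof (rule ringI)
  show "abelian_group ?M"
  proof (rule abelian_groupI)
    fix x assume "x \<in> carrier ?M"
    then obtain p q r s where "x = (p, q, r, s)"
      and "p \<in> carrier R" "q \<in> carrier R" "r \<in> carrier R" "s \<in> carrier R"
      by (auto simp: mat2_ring_def)
    then show "\<exists>y\<in>carrier ?M. y \<oplus>\<^bsub>?M\<^esub> x = \<zero>\<^bsub>?M\<^esub>"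
      by (intro bexI[of _ "(\<ominus> p, \<ominus> q, \<ominus> r, \<ominus> s)"]) (auto simp: mat2_ring_def l_neg)
  qed (auto simp: mat2_ring_def a_ac)
  show "Group.monoid ?M"
    by (rule monoidI) (auto simp: mat2_ring_def l_distr r_distr a_ac m_assoc)
qed (auto simp: mat2_ring_def l_distr r_distr a_ac)

end

theory Submission
  imports Defs
begin

text \<open>
  Write \<open>(a, b)\<close> for the quaternion ring with \<open>i\<^sup>2 = a\<close> and \<open>j\<^sup>2 = b\<close>. Up to isomorphism one may
  exchange \<open>a\<close> and \<open>b\<close> (\<open>quaternion_ring_swap\<close>), and multiply \<open>b\<close> by any unit of the form
  \<open>x\<^sup>2 - a y\<^sup>2\<close>, since \<open>j\<close> may be replaced by \<open>(x + y i) j\<close> (\<open>quaternion_ring_norm\<close>). Combining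
  the two moves, a unit \<open>c = a x\<^sup>2 + b y\<^sup>2\<close> modulo \<open>n\<close> yields \<open>(a, b) \<cong> (c, -a b)\<close> when \<open>a\<close> is a
  unit (\<open>quaternion_mod_represent\<close>). The classification thus becomes a question about the values
  of binary quadratic forms.

  For odd \<open>n\<close> the form represents \<open>1\<close>: modulo a prime by the pigeonhole principle, then modulo
  prime powers by Hensel lifting and modulo \<open>n\<close> by the Chinese remainder theorem
  (\<open>ex_ax2_by2_cong_odd\<close>). So \<open>(a, b) \<cong> (1, -a b)\<close>, and \<open>(1, c)\<close> is the matrix ring because
  \<open>2\<close> and \<open>c = -a b\<close> are units (\<open>quaternion_ring_split\<close>).

  For \<open>n = 2\<^sup>s\<close> the form represents every \<open>c\<close> congruent to \<open>a\<close> modulo \<open>4\<close>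
  (\<open>ex_ax2_by2_cong_power_2\<close>). If \<open>a\<close> is congruent to \<open>1\<close> modulo \<open>4\<close>, this gives \<open>(a, b) \<cong> (1, -a b)\<close>,
  which is \<open>(1, 1)\<close> because every odd number is a norm \<open>x\<^sup>2 - y\<^sup>2\<close>. If both \<open>a\<close> and \<open>b\<close> are
  congruent to \<open>-1\<close>, it gives \<open>(-1, -a b)\<close>, which is \<open>(-1, -1)\<close> because \<open>a b\<close>, being congruent to
  \<open>1\<close> modulo \<open>4\<close>, is a norm \<open>x\<^sup>2 + y\<^sup>2\<close>. For \<open>s = 1\<close> all odd parameters coincide.

  The general case follows because the quaternion ring over \<open>\<int>/mn\<close> with \<open>m\<close>, \<open>n\<close> coprime is the
  product of those over \<open>\<int>/m\<close> and \<open>\<int>/n\<close> (\<open>quaternion_mod_chinese_remainder\<close>).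
\<close>

section \<open>Isomorphisms between quaternion rings\<close>

lemma ring_iso_byWitness:
  assumes "h \<in> ring_hom R S"
    and "\<And>y. y \<in> carrier S \<Longrightarrow> g y \<in> carrier R"
    and "\<And>x. x \<in> carrier R \<Longrightarrow> g (h x) = x"
    and "\<And>y. y \<in> carrier S \<Longrightarrow> h (g y) = y"
  shows "R \<simeq> S"
proof -
  have "bij_betw h (carrier R) (carrier S)"
    by (rule bij_betw_byWitness[of _ g]) (use assms in \<open>auto dest: ring_hom_memE(1)\<close>)
  then show ?thesis
    using assms(1) by (auto simp: is_ring_iso_def ring_iso_def)
qed

context cring
begin

text \<open>
  These rules bring both sides of an equation into the form \<open>x \<ominus> y\<close> with \<open>x\<close> and \<open>y\<close>
  free of subtraction, and then remove the subtractions by moving terms across. Together with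
  distributivity and the rules for associativity and commutativity they decide polynomial
  identities without unary minus.
\<close>

lemma minus_simps:
  assumes [simp]: "x \<in> carrier R" "y \<in> carrier R" "z \<in> carrier R"
  shows "(x \<ominus> y) \<oplus> z = (x \<oplus> z) \<ominus> y"
    and "z \<oplus> (x \<ominus> y) = (z \<oplus> x) \<ominus> y"
    and "(x \<ominus> y) \<ominus> z = x \<ominus> (y \<oplus> z)"
    and "z \<ominus> (x \<ominus> y) = (z \<oplus> y) \<ominus> x"
    and "(x \<ominus> y) \<otimes> z = x \<otimes> z \<ominus> y \<otimes> z"
    and "z \<otimes> (x \<ominus> y) = z \<otimes> x \<ominus> z \<otimes> y"
    and "x \<ominus> y = z \<longleftrightarrow> x = z \<oplus> y"
    and "z = x \<ominus> y \<longleftrightarrow> z \<oplus> y = x"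
proof -
  show "x \<ominus> y = z \<longleftrightarrow> x = z \<oplus> y"
    unfolding a_minus_def by (rule add.inv_solve_right') simp_all
  then show "z = x \<ominus> y \<longleftrightarrow> z \<oplus> y = x"
    by auto
qed (simp_all add: a_minus_def minus_add l_distr r_distr l_minus r_minus a_ac)

lemmas polynomial_simps = minus_simps l_distr r_distr a_ac m_ac

text \<open>The isomorphism exchanges \<open>i\<close> and \<open>j\<close>, hence sends \<open>k = ij\<close> to \<open>ji = -k\<close>.\<close>

lemma quaternion_ring_swap:
  assumes [simp]: "a \<in> carrier R" "b \<in> carrier R"
  shows "quaternion_ring R a b \<simeq> quaternion_ring R b a" (is "?Q \<simeq> ?Q'")
proof -
  let ?h = "\<lambda>(x0, x1, x2, x3). (x0, x2, x1, \<ominus> x3)"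
  show ?thesis
  proof (rule ring_iso_byWitness[where g = ?h])
    show "?h \<in> ring_hom ?Q ?Q'"
    proof (rule ring_hom_memI)
      fix p q assume "p \<in> carrier ?Q" "q \<in> carrier ?Q"
      then obtain x0 x1 x2 x3 y0 y1 y2 y3 where pq: "p = (x0, x1, x2, x3)" "q = (y0, y1, y2, y3)"
        and [simp]: "x0 \<in> carrier R" "x1 \<in> carrier R" "x2 \<in> carrier R" "x3 \<in> carrier R"
          "y0 \<in> carrier R" "y1 \<in> carrier R" "y2 \<in> carrier R" "y3 \<in> carrier R"
        by (auto simp: quaternion_ring_def)
      show "?h (p \<otimes>\<^bsub>?Q\<^esub> q) = ?h p \<otimes>\<^bsub>?Q'\<^esub> ?h q"
        by (simp add: pq quaternion_ring_def a_minus_def l_minus r_minus minus_add a_ac m_ac)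
      show "?h (p \<oplus>\<^bsub>?Q\<^esub> q) = ?h p \<oplus>\<^bsub>?Q'\<^esub> ?h q"
        by (simp add: pq quaternion_ring_def a_minus_def l_minus r_minus minus_add a_ac m_ac)
    qed (auto simp: quaternion_ring_def)
  qed (auto simp: quaternion_ring_def)
qed

text \<open>
  The isomorphism fixes \<open>i\<close> and sends \<open>j\<close> to \<open>(x + y i) j\<close>, which anticommutes with \<open>i\<close> and whose
  square is the norm \<open>x\<^sup>2 - a y\<^sup>2\<close> of \<open>x + y i\<close> times \<open>b\<close>. On the span of \<open>j\<close> and \<open>k\<close> its
  determinant is that norm.
\<close>

lemma quaternion_ring_norm:
  assumes [simp]: "a \<in> carrier R" "b \<in> carrier R" "x \<in> carrier R" "y \<in> carrier R"
    and v: "x \<otimes> x \<ominus> a \<otimes> (y \<otimes> y) \<in> Units R"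
  shows "quaternion_ring R a ((x \<otimes> x \<ominus> a \<otimes> (y \<otimes> y)) \<otimes> b) \<simeq> quaternion_ring R a b"
    (is "?Q' \<simeq> ?Q")
proof -
  define w where "w = inv (x \<otimes> x \<ominus> a \<otimes> (y \<otimes> y))"
  have w [simp]: "w \<in> carrier R"
    using v by (simp add: w_def)
  have wv: "w \<otimes> (x \<otimes> x \<ominus> a \<otimes> (y \<otimes> y)) \<otimes> p = p" if "p \<in> carrier R" for p
    using v that unfolding w_def by (subst Units_l_inv) simp_all
  let ?h = "\<lambda>(x0, x1, x2, x3).
    (x0, x1, x \<otimes> x2 \<oplus> a \<otimes> (y \<otimes> x3), y \<otimes> x2 \<oplus> x \<otimes> x3)"
  let ?g = "\<lambda>(x0, x1, x2, x3).
    (x0, x1, w \<otimes> (x \<otimes> x2 \<ominus> a \<otimes> (y \<otimes> x3)), w \<otimes> (x \<otimes> x3 \<ominus> y \<otimes> x2))"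
  show ?thesis
  proof (rule ring_iso_byWitness)
    show "?h \<in> ring_hom ?Q' ?Q"
    proof (rule ring_hom_memI)
      fix p q assume "p \<in> carrier ?Q'" "q \<in> carrier ?Q'"
      then obtain x0 x1 x2 x3 y0 y1 y2 y3 where pq: "p = (x0, x1, x2, x3)" "q = (y0, y1, y2, y3)"
        and [simp]: "x0 \<in> carrier R" "x1 \<in> carrier R" "x2 \<in> carrier R" "x3 \<in> carrier R"
          "y0 \<in> carrier R" "y1 \<in> carrier R" "y2 \<in> carrier R" "y3 \<in> carrier R"
        by (auto simp: quaternion_ring_def)
      show "?h (p \<otimes>\<^bsub>?Q'\<^esub> q) = ?h p \<otimes>\<^bsub>?Q\<^esub> ?h q"
        by (simp add: pq quaternion_ring_def polynomial_simps)
      show "?h (p \<oplus>\<^bsub>?Q'\<^esub> q) = ?h p \<oplus>\<^bsub>?Q\<^esub> ?h q"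
        by (simp add: pq quaternion_ring_def polynomial_simps)
    qed (auto simp: quaternion_ring_def)
    fix p assume "p \<in> carrier ?Q'"
    then obtain x0 x1 x2 x3 where p: "p = (x0, x1, x2, x3)"
      and [simp]: "x0 \<in> carrier R" "x1 \<in> carrier R" "x2 \<in> carrier R" "x3 \<in> carrier R"
      by (auto simp: quaternion_ring_def)
    have "w \<otimes> (x \<otimes> (x \<otimes> x2 \<oplus> a \<otimes> (y \<otimes> x3)) \<ominus> a \<otimes> (y \<otimes> (y \<otimes> x2 \<oplus> x \<otimes> x3)))
        = w \<otimes> (x \<otimes> x \<ominus> a \<otimes> (y \<otimes> y)) \<otimes> x2"
      by (simp add: polynomial_simps)
    moreover have "w \<otimes> (x \<otimes> (y \<otimes> x2 \<oplus> x \<otimes> x3) \<ominus> y \<otimes> (x \<otimes> x2 \<oplus> a \<otimes> (y \<otimes> x3)))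
        = w \<otimes> (x \<otimes> x \<ominus> a \<otimes> (y \<otimes> y)) \<otimes> x3"
      by (simp add: polynomial_simps)
    ultimately show "?g (?h p) = p"
      by (simp add: p wv)
  next
    fix p assume "p \<in> carrier ?Q"
    then obtain x0 x1 x2 x3 where p: "p = (x0, x1, x2, x3)"
      and [simp]: "x0 \<in> carrier R" "x1 \<in> carrier R" "x2 \<in> carrier R" "x3 \<in> carrier R"
      by (auto simp: quaternion_ring_def)
    have "x \<otimes> (w \<otimes> (x \<otimes> x2 \<ominus> a \<otimes> (y \<otimes> x3))) \<oplus> a \<otimes> (y \<otimes> (w \<otimes> (x \<otimes> x3 \<ominus> y \<otimes> x2)))
        = w \<otimes> (x \<otimes> x \<ominus> a \<otimes> (y \<otimes> y)) \<otimes> x2"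
      by (simp add: polynomial_simps)
    moreover have "y \<otimes> (w \<otimes> (x \<otimes> x2 \<ominus> a \<otimes> (y \<otimes> x3))) \<oplus> x \<otimes> (w \<otimes> (x \<otimes> x3 \<ominus> y \<otimes> x2))
        = w \<otimes> (x \<otimes> x \<ominus> a \<otimes> (y \<otimes> y)) \<otimes> x3"
      by (simp add: polynomial_simps)
    ultimately show "?h (?g p) = p"
      by (simp add: p wv)
  qed (auto simp: quaternion_ring_def)
qed

text \<open>
  The isomorphism sends \<open>i\<close> to \<open>diag(1, -1)\<close> and \<open>j\<close> to the matrix with rows \<open>(0, b)\<close> and \<open>(1, 0)\<close>;
  its inverse divides by \<open>2\<close> and \<open>b\<close>.
\<close>

lemma quaternion_ring_split:
  assumes b: "b \<in> Units R" and two: "\<one> \<oplus> \<one> \<in> Units R"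
  shows "quaternion_ring R \<one> b \<simeq> mat2_ring R" (is "?Q \<simeq> ?M")
proof -
  define c t where "c = inv b" and "t = inv (\<one> \<oplus> \<one>)"
  have [simp]: "b \<in> carrier R" "c \<in> carrier R" "t \<in> carrier R"
    using b two by (auto simp: c_def t_def)
  have cb: "c \<otimes> b = \<one>" and t2: "t \<otimes> (\<one> \<oplus> \<one>) = \<one>"
    using b two by (simp_all add: c_def t_def)
  let ?h = "\<lambda>(x0, x1, x2, x3). (x0 \<oplus> x1, b \<otimes> (x2 \<oplus> x3), x2 \<ominus> x3, x0 \<ominus> x1)"
  let ?g = "\<lambda>(p, q, r, s).
    (t \<otimes> (p \<oplus> s), t \<otimes> (p \<ominus> s), t \<otimes> (c \<otimes> q \<oplus> r), t \<otimes> (c \<otimes> q \<ominus> r))"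
  show ?thesis
  proof (rule ring_iso_byWitness)
    show "?h \<in> ring_hom ?Q ?M"
    proof (rule ring_hom_memI)
      fix p q assume "p \<in> carrier ?Q" "q \<in> carrier ?Q"
      then obtain x0 x1 x2 x3 y0 y1 y2 y3 where pq: "p = (x0, x1, x2, x3)" "q = (y0, y1, y2, y3)"
        and [simp]: "x0 \<in> carrier R" "x1 \<in> carrier R" "x2 \<in> carrier R" "x3 \<in> carrier R"
          "y0 \<in> carrier R" "y1 \<in> carrier R" "y2 \<in> carrier R" "y3 \<in> carrier R"
        by (auto simp: quaternion_ring_def)
      show "?h (p \<otimes>\<^bsub>?Q\<^esub> q) = ?h p \<otimes>\<^bsub>?M\<^esub> ?h q"
        by (simp add: pq quaternion_ring_def mat2_ring_def polynomial_simps)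
      show "?h (p \<oplus>\<^bsub>?Q\<^esub> q) = ?h p \<oplus>\<^bsub>?M\<^esub> ?h q"
        by (simp add: pq quaternion_ring_def mat2_ring_def polynomial_simps)
    qed (auto simp: quaternion_ring_def mat2_ring_def a_minus_def)
    fix p assume "p \<in> carrier ?Q"
    then obtain x0 x1 x2 x3 where p: "p = (x0, x1, x2, x3)"
      and [simp]: "x0 \<in> carrier R" "x1 \<in> carrier R" "x2 \<in> carrier R" "x3 \<in> carrier R"
      by (auto simp: quaternion_ring_def)
    have "t \<otimes> (x0 \<oplus> x1 \<oplus> (x0 \<ominus> x1)) = t \<otimes> (\<one> \<oplus> \<one>) \<otimes> x0"
      "t \<otimes> (x0 \<oplus> x1 \<ominus> (x0 \<ominus> x1)) = t \<otimes> (\<one> \<oplus> \<one>) \<otimes> x1"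
      by (simp_all add: polynomial_simps)
    moreover have "c \<otimes> (b \<otimes> (x2 \<oplus> x3)) = x2 \<oplus> x3"
      using cb by (simp flip: m_assoc)
    moreover have "t \<otimes> (x2 \<oplus> x3 \<oplus> (x2 \<ominus> x3)) = t \<otimes> (\<one> \<oplus> \<one>) \<otimes> x2"
      "t \<otimes> (x2 \<oplus> x3 \<ominus> (x2 \<ominus> x3)) = t \<otimes> (\<one> \<oplus> \<one>) \<otimes> x3"
      by (simp_all add: polynomial_simps)
    ultimately show "?g (?h p) = p"
      by (simp add: p t2)
  next
    fix p assume "p \<in> carrier ?M"
    then obtain x0 x1 x2 x3 where p: "p = (x0, x1, x2, x3)"
      and [simp]: "x0 \<in> carrier R" "x1 \<in> carrier R" "x2 \<in> carrier R" "x3 \<in> carrier R"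
      by (auto simp: mat2_ring_def)
    have "t \<otimes> (x0 \<oplus> x3) \<oplus> t \<otimes> (x0 \<ominus> x3) = t \<otimes> (\<one> \<oplus> \<one>) \<otimes> x0"
      "t \<otimes> (x0 \<oplus> x3) \<ominus> t \<otimes> (x0 \<ominus> x3) = t \<otimes> (\<one> \<oplus> \<one>) \<otimes> x3"
      "b \<otimes> (t \<otimes> (c \<otimes> x1 \<oplus> x2) \<oplus> t \<otimes> (c \<otimes> x1 \<ominus> x2)) = t \<otimes> (\<one> \<oplus> \<one>) \<otimes> (c \<otimes> b) \<otimes> x1"
      "t \<otimes> (c \<otimes> x1 \<oplus> x2) \<ominus> t \<otimes> (c \<otimes> x1 \<ominus> x2) = t \<otimes> (\<one> \<oplus> \<one>) \<otimes> x2"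
      by (simp_all add: polynomial_simps)
    then show "?h (?g p) = p"
      by (simp add: p t2 cb)
  qed (auto simp: quaternion_ring_def mat2_ring_def)
qed

end

section \<open>Change of base ring and direct products\<close>

lemma quaternion_ring_cong:
  assumes "cring R" "cring S" and h: "h \<in> ring_iso R S" and a: "a \<in> carrier R" and b: "b \<in> carrier R"
  shows "quaternion_ring R a b \<simeq> quaternion_ring S (h a) (h b)" (is "?Q \<simeq> ?Q'")
proof -
  interpret R: cring R by fact
  interpret S: cring S by fact
  interpret ring_hom_cring R S h
    by unfold_locales (use h in \<open>simp add: ring_iso_def\<close>)
  have bij: "bij_betw h (carrier R) (carrier S)"
    using h by (simp add: ring_iso_def)
  let ?g = "inv_into (carrier R) h"
  have inj: "inj_on h (carrier R)" and surj: "h ` carrier R = carrier S"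
    using bij by (simp_all add: bij_betw_def)
  show ?thesis
  proof (rule ring_iso_byWitness)
    show "(\<lambda>(x0, x1, x2, x3). (h x0, h x1, h x2, h x3)) \<in> ring_hom ?Q ?Q'"
      by (rule ring_hom_memI) (use a b in \<open>auto simp: quaternion_ring_def a_minus_def\<close>)
  next
    fix y assume "y \<in> carrier ?Q'"
    then show "(\<lambda>(x0, x1, x2, x3). (?g x0, ?g x1, ?g x2, ?g x3)) y \<in> carrier ?Q"
      by (auto simp: quaternion_ring_def inv_into_into surj)
  next
    fix x assume "x \<in> carrier ?Q"
    then show "(\<lambda>(x0, x1, x2, x3). (?g x0, ?g x1, ?g x2, ?g x3))
        ((\<lambda>(x0, x1, x2, x3). (h x0, h x1, h x2, h x3)) x) = x"
      using inj by (auto simp: quaternion_ring_def)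
  next
    fix y assume "y \<in> carrier ?Q'"
    then show "(\<lambda>(x0, x1, x2, x3). (h x0, h x1, h x2, h x3))
        ((\<lambda>(x0, x1, x2, x3). (?g x0, ?g x1, ?g x2, ?g x3)) y) = y"
      by (auto simp: quaternion_ring_def f_inv_into_f surj)
  qed
qed

lemma RDirProd_simps:
  "(x, y) \<otimes>\<^bsub>RDirProd R S\<^esub> (x', y') = (x \<otimes>\<^bsub>R\<^esub> x', y \<otimes>\<^bsub>S\<^esub> y')"
  "(x, y) \<oplus>\<^bsub>RDirProd R S\<^esub> (x', y') = (x \<oplus>\<^bsub>R\<^esub> x', y \<oplus>\<^bsub>S\<^esub> y')"
  "\<one>\<^bsub>RDirProd R S\<^esub> = (\<one>\<^bsub>R\<^esub>, \<one>\<^bsub>S\<^esub>)"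
  "\<zero>\<^bsub>RDirProd R S\<^esub> = (\<zero>\<^bsub>R\<^esub>, \<zero>\<^bsub>S\<^esub>)"
  by (simp_all add: RDirProd_def DirProd_def monoid.defs)

lemma RDirProd_cring:
  assumes "cring R" "cring S"
  shows "cring (RDirProd R S)"
proof -
  interpret R: cring R by fact
  interpret S: cring S by fact
  interpret ring "RDirProd R S"
    by (rule RDirProd_ring) unfold_locales
  show ?thesis
    by unfold_locales (auto simp: RDirProd_carrier RDirProd_simps R.m_comm S.m_comm)
qed

lemma RDirProd_a_minus:
  assumes "ring R" "ring S" 
    and "x \<in> carrier R" "x' \<in> carrier R" "y \<in> carrier S" "y' \<in> carrier S"
  shows "(x, y) \<ominus>\<^bsub>RDirProd R S\<^esub> (x', y') = (x \<ominus>\<^bsub>R\<^esub> x', y \<ominus>\<^bsub>S\<^esub> y')"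
proof -
  interpret R: ring R by fact
  interpret S: ring S by fact
  interpret ring "RDirProd R S"
    by (rule RDirProd_ring) unfold_locales
  have "\<ominus>\<^bsub>RDirProd R S\<^esub> (x', y') = (\<ominus>\<^bsub>R\<^esub> x', \<ominus>\<^bsub>S\<^esub> y')"
    by (rule minus_equality)
      (use assms(3-6) in \<open>auto simp: RDirProd_carrier RDirProd_simps R.l_neg S.l_neg\<close>)
  then show ?thesis
    by (simp add: a_minus_def RDirProd_simps)
qed

lemma quaternion_ring_RDirProd:
  assumes R: "cring R" and S: "cring S"
    and ab: "a \<in> carrier R" "b \<in> carrier R" "a' \<in> carrier S" "b' \<in> carrier S"
  shows "quaternion_ring (RDirProd R S) (a, a') (b, b')
    \<simeq> RDirProd (quaternion_ring R a b) (quaternion_ring S a' b')" (is "?Q \<simeq> ?P")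
proof -
  interpret R: cring R by fact
  interpret S: cring S by fact
  note minus = RDirProd_a_minus[OF R.ring_axioms S.ring_axioms]
  show ?thesis
  proof (rule ring_iso_byWitness)
    show "(\<lambda>((x0, y0), (x1, y1), (x2, y2), (x3, y3)). ((x0, x1, x2, x3), (y0, y1, y2, y3)))
        \<in> ring_hom ?Q ?P"
      by (rule ring_hom_memI)
        (use ab in \<open>auto simp: quaternion_ring_def RDirProd_carrier RDirProd_simps minus\<close>)
  next
    fix z assume "z \<in> carrier ?P"
    then show "(\<lambda>((x0, x1, x2, x3), (y0, y1, y2, y3)). ((x0, y0), (x1, y1), (x2, y2), (x3, y3))) z
        \<in> carrier ?Q"
      by (auto simp: quaternion_ring_def RDirProd_carrier)
  qed (auto simp: quaternion_ring_def RDirProd_carrier)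
qed

section \<open>Binary diagonal quadratic congruences\<close>

text \<open>
  Successive approximation: from the modulus \<open>2 ^ (t + 3)\<close> to the next power of two, either
  \<open>x\<close> or \<open>x + 2 ^ (t + 2)\<close> works. The oddness of \<open>x\<close> is carried along because
  this step needs it.
\<close>

lemma ex_ax2_cong_power_2:
  fixes a w :: int
  assumes "odd a" and w: "[a = w] (mod 8)"
  shows "\<exists>x. odd x \<and> [a * x\<^sup>2 = w] (mod 2 ^ s)"
proof -
  have "\<exists>x. odd x \<and> [a * x\<^sup>2 = w] (mod 2 ^ (t + 3))" for t
  proof (induction t)
    case 0
    then show ?case
      using w by (intro exI[of _ 1]) simp
  next
    case (Suc t)
    then obtain x k where x: "odd x" and k: "a * x\<^sup>2 - w = 2 ^ (t + 3) * k"
      by (auto simp: cong_iff_dvd_diff dvd_def)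
    show ?case
    proof (cases "even k")
      case True
      then show ?thesis
        using x k by (intro exI[of _ x]) (auto simp: cong_iff_dvd_diff power_add elim!: evenE)
    next
      case False
      define y where "y = x + 2 ^ (t + 2)"
      have "a * y\<^sup>2 - w = (a * x\<^sup>2 - w) + 2 ^ (t + 3) * (a * x) + 2 ^ (t + 4) * (a * 2 ^ t)"
        by (simp add: y_def power2_eq_square power_add algebra_simps)
      also have "\<dots> = 2 ^ (t + 3) * (k + a * x) + 2 ^ (t + 4) * (a * 2 ^ t)"
        by (simp add: k algebra_simps)
      finally have y: "a * y\<^sup>2 - w = 2 ^ (t + 3) * (k + a * x) + 2 ^ (t + 4) * (a * 2 ^ t)" .
      have "even (k + a * x)"
        using False x \<open>odd a\<close> by simp
      then obtain l where l: "k + a * x = 2 * l" ..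
      have "[a * y\<^sup>2 = w] (mod 2 ^ (Suc t + 3))"
        unfolding cong_iff_dvd_diff y l by (simp add: power_add)
      moreover have "odd y"
        using x by (simp add: y_def)
      ultimately show ?thesis
        by blast
    qed
  qed
  then obtain x where "odd x" "[a * x\<^sup>2 = w] (mod 2 ^ (s + 3))"
    by blast
  moreover have "(2::int) ^ s dvd 2 ^ (s + 3)"
    by (simp add: le_imp_power_dvd)
  ultimately show ?thesis
    using cong_dvd_modulus by blast
qed

text \<open>
  Modulo \<open>8\<close>, \<open>c\<close> is \<open>a\<close> or \<open>a + 4\<close>, and \<open>4 b\<close> is \<open>4\<close>; so \<open>c - b y\<^sup>2\<close> is congruent
  to \<open>a\<close> for \<open>y = 0\<close> or for \<open>y = 2\<close>.
\<close>

lemma ex_ax2_by2_cong_power_2: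
  fixes a b c :: int
  assumes "odd a" "odd b" and c: "[c = a] (mod 4)"
  shows "\<exists>x y. [a * x\<^sup>2 + b * y\<^sup>2 = c] (mod 2 ^ s)"
proof -
  obtain y where y: "[a = c - b * y\<^sup>2] (mod 8)"
  proof (cases "[a = c] (mod 8)")
    case True
    with that[of 0] show ?thesis
      by simp
  next
    case False
    obtain k where k: "c = a + 4 * k"
      using cong_sym[OF c] by (auto simp: cong_iff_lin)
    have "odd k"
    proof
      assume "even k"
      with k have "[a = c] (mod 8)"
        by (auto simp: cong_iff_lin elim!: evenE)
      with False show False ..
    qed
    then obtain l where "k - b = 2 * l"
      using \<open>odd b\<close> by (metis dvdE even_diff_iff even_add odd_even_add diff_conv_add_uminus even_minus)
    then have "c - b * 2\<^sup>2 = a + 8 * l"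
      using k by simp
    then show ?thesis
      using that[of 2] by (simp add: cong_iff_lin)
  qed
  from ex_ax2_cong_power_2[OF \<open>odd a\<close> y, of s] obtain x
    where "[a * x\<^sup>2 = c - b * y\<^sup>2] (mod 2 ^ s)"
    by blast
  then have "[a * x\<^sup>2 + b * y\<^sup>2 = c] (mod 2 ^ s)"
    by (metis cong_add_rcancel diff_add_cancel)
  then show ?thesis
    by blast
qed

lemma inj_on_ax2_mod_prime:
  fixes a c :: int
  assumes "prime p" and "\<not> p dvd a" and "p = 2 * h + 1"
  shows "inj_on (\<lambda>x. (c + a * x\<^sup>2) mod p) {0..h}"
proof (rule inj_onI)
  fix x y assume xy: "x \<in> {0..h}" "y \<in> {0..h}"
  assume "(c + a * x\<^sup>2) mod p = (c + a * y\<^sup>2) mod p"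
  then have "p dvd (c + a * x\<^sup>2) - (c + a * y\<^sup>2)"
    by (simp add: mod_eq_dvd_iff)
  also have "(c + a * x\<^sup>2) - (c + a * y\<^sup>2) = a * ((x + y) * (x - y))"
    by (simp add: power2_eq_square algebra_simps)
  finally have "p dvd x + y \<or> p dvd x - y"
    using assms(1,2) by (simp add: prime_dvd_mult_iff)
  then show "x = y"
  proof
    assume "p dvd x + y"
    then have "x + y = 0"
      using xy assms(3) zdvd_imp_le[of p "x + y"] by (cases "x + y = 0") auto
    with xy show ?thesis
      by simp
  next
    assume "p dvd x - y"
    moreover have "\<bar>x - y\<bar> < p"
      using xy assms(3) by auto
    ultimately show ?thesis
      using dvd_imp_le_int[of "x - y" p] by auto
  qed
qed

text \<open>
  Pigeonhole principle: \<open>a x\<^sup>2\<close> and \<open>c - b y\<^sup>2\<close> each take \<open>(p + 1) / 2\<close> values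
  modulo \<open>p\<close>, so they share one.
\<close>

lemma ex_ax2_by2_cong_prime:
  fixes a b c p :: int
  assumes p: "prime p" "odd p" and "\<not> p dvd a" "\<not> p dvd b"
  shows "\<exists>x y. [a * x\<^sup>2 + b * y\<^sup>2 = c] (mod p)"
proof -
  obtain h where h: "p = 2 * h + 1"
    using p(2) by (elim oddE)
  have "p > 0"
    using p(1) by (rule prime_gt_0_int)
  \<comment> \<open>The summand \<open>0\<close> and the coefficient \<open>- b\<close> match the form of \<open>inj_on_ax2_mod_prime\<close>.\<close>
  define A where "A = (\<lambda>x. (0 + a * x\<^sup>2) mod p) ` {0..h}"
  define B where "B = (\<lambda>y. (c + (- b) * y\<^sup>2) mod p) ` {0..h}"
  have card: "card A = nat (h + 1)" "card B = nat (h + 1)"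
    unfolding A_def B_def using assms h
    by (simp_all only: card_image inj_on_ax2_mod_prime dvd_minus_iff not_False_eq_True
        card_atLeastAtMost_int diff_zero)
  have "A \<inter> B \<noteq> {}"
  proof
    assume "A \<inter> B = {}"
    then have "card (A \<union> B) = 2 * nat (h + 1)"
      using card by (subst card_Un_disjoint) (auto simp: A_def B_def)
    moreover have "card (A \<union> B) \<le> card {0..<p}"
      by (rule card_mono) (use \<open>p > 0\<close> in \<open>auto simp: A_def B_def\<close>)
    ultimately show False
      using h \<open>p > 0\<close> by simp
  qed
  then obtain x y where "(0 + a * x\<^sup>2) mod p = (c + (- b) * y\<^sup>2) mod p"
    by (auto simp: A_def B_def)
  then have "[a * x\<^sup>2 + b * y\<^sup>2 = c + (- b) * y\<^sup>2 + b * y\<^sup>2] (mod p)"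
    by (intro cong_add) (auto simp: cong_def)
  then show ?thesis
    by auto
qed

text \<open>
  Newton's step: replacing \<open>x\<close> by \<open>x + n t\<close> changes \<open>a x\<^sup>2\<close> by \<open>2 a x t n\<close> modulo \<open>p n\<close>, and
  \<open>2 a x\<close> is invertible modulo \<open>p\<close>.
\<close>

lemma ex_ax2_by2_cong_lift_aux:
  fixes a b c p n x y :: int
  assumes p: "prime p" "odd p" and "\<not> p dvd a" "p dvd n"
    and xy: "[a * x\<^sup>2 + b * y\<^sup>2 = c] (mod n)" and x: "\<not> p dvd x"
  shows "\<exists>z. [a * z\<^sup>2 + b * y\<^sup>2 = c] (mod p * n)"
proof -
  obtain k where k: "a * x\<^sup>2 + b * y\<^sup>2 - c = n * k"
    using xy by (auto simp: cong_iff_dvd_diff dvd_def)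
  have "\<not> p dvd 2"
    using p primes_dvd_imp_eq[of p 2] by auto
  then have "\<not> p dvd 2 * a * x"
    using assms by (simp add: prime_dvd_mult_iff)
  then have "coprime (2 * a * x) p"
    using p(1) prime_imp_coprime[of p "2 * a * x"] by (simp add: coprime_commute)
  then obtain t where "[2 * a * x * t = - k] (mod p)"
    by (metis cong_solve_coprime_int cong_scalar_right mult.assoc mult_1 )
  then obtain l where l: "2 * a * x * t + k = p * l"
    by (auto simp: cong_iff_dvd_diff dvd_def)
  obtain m where m: "n = p * m"
    using \<open>p dvd n\<close> by (auto simp: dvd_def)
  have "a * (x + n * t)\<^sup>2 + b * y\<^sup>2 - c = (a * x\<^sup>2 + b * y\<^sup>2 - c) + n * (2 * a * x * t) + n * n * (a * t\<^sup>2)"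
    by (simp add: power2_eq_square algebra_simps)
  also have "\<dots> = n * (2 * a * x * t + k) + n * n * (a * t\<^sup>2)"
    by (simp add: k algebra_simps)
  also have "\<dots> = p * n * (l + m * (a * t\<^sup>2))"
    unfolding l by (simp add: m algebra_simps)
  finally show ?thesis
    by (intro exI[of _ "x + n * t"]) (simp add: cong_iff_dvd_diff)
qed

text \<open>Since \<open>p\<close> does not divide \<open>c\<close>, it cannot divide both \<open>x\<close> and \<open>y\<close>.\<close>

lemma ex_ax2_by2_cong_lift:
  fixes a b c p n :: int
  assumes p: "prime p" "odd p" and ab: "\<not> p dvd a" "\<not> p dvd b" and c: "\<not> p dvd c" and "p dvd n"
    and ex: "\<exists>x y. [a * x\<^sup>2 + b * y\<^sup>2 = c] (mod n)"
  shows "\<exists>x y. [a * x\<^sup>2 + b * y\<^sup>2 = c] (mod p * n)"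
proof -
  obtain x y where xy: "[a * x\<^sup>2 + b * y\<^sup>2 = c] (mod n)"
    using ex by blast
  have "\<not> (p dvd x \<and> p dvd y)"
  proof
    assume "p dvd x \<and> p dvd y"
    then have "p dvd a * x\<^sup>2 + b * y\<^sup>2"
      by (auto simp: power2_eq_square)
    moreover have "[a * x\<^sup>2 + b * y\<^sup>2 = c] (mod p)"
      using xy \<open>p dvd n\<close> by (rule cong_dvd_modulus)
    ultimately show False
      using c by (simp add: cong_dvd_iff)
  qed
  then consider "\<not> p dvd x" | "\<not> p dvd y"
    by blast
  then show ?thesis
  proof cases
    case 1
    then show ?thesis
      using ex_ax2_by2_cong_lift_aux[OF p ab(1) \<open>p dvd n\<close> xy] by blast
  next
    case 2
    moreover have "[b * y\<^sup>2 + a * x\<^sup>2 = c] (mod n)"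
      using xy by (simp add: add.commute)
    ultimately obtain z where "[b * z\<^sup>2 + a * x\<^sup>2 = c] (mod p * n)"
      using ex_ax2_by2_cong_lift_aux[OF p ab(2) \<open>p dvd n\<close>] by blast
    then show ?thesis
      by (auto simp: add.commute)
  qed
qed

lemma ex_ax2_by2_cong_coprime:
  fixes a b c m n :: int
  assumes "coprime m n"
    and "\<exists>x y. [a * x\<^sup>2 + b * y\<^sup>2 = c] (mod m)" "\<exists>x y. [a * x\<^sup>2 + b * y\<^sup>2 = c] (mod n)"
  shows "\<exists>x y. [a * x\<^sup>2 + b * y\<^sup>2 = c] (mod m * n)"
proof -
  obtain x y x' y' where m: "[a * x\<^sup>2 + b * y\<^sup>2 = c] (mod m)" and n: "[a * x'\<^sup>2 + b * y'\<^sup>2 = c] (mod n)"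
    using assms by blast
  obtain u where u: "[u = x] (mod m)" "[u = x'] (mod n)"
    using binary_chinese_remainder_int[OF \<open>coprime m n\<close>] by blast
  obtain v where v: "[v = y] (mod m)" "[v = y'] (mod n)"
    using binary_chinese_remainder_int[OF \<open>coprime m n\<close>] by blast
  have "[a * u\<^sup>2 + b * v\<^sup>2 = c] (mod m)"
    by (rule cong_trans[OF _ m]) (intro cong_add cong_mult cong_pow cong_refl u v)
  moreover have "[a * u\<^sup>2 + b * v\<^sup>2 = c] (mod n)"
    by (rule cong_trans[OF _ n]) (intro cong_add cong_mult cong_pow cong_refl u v)
  ultimately show ?thesis
    using coprime_cong_mult[OF _ _ \<open>coprime m n\<close>] by blast
qed

lemma ex_ax2_by2_cong_odd:
  fixes a b c n :: int
  assumes "odd n" and "coprime a n" "coprime b n" "coprime c n"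
  shows "\<exists>x y. [a * x\<^sup>2 + b * y\<^sup>2 = c] (mod n)"
  using assms
proof (induction n rule: prime_divisors_induct)
  case (unit n)
  then show ?case
    using unit_imp_dvd[of n] by (auto simp: cong_iff_dvd_diff simp del: zdvd1_eq)
next
  case (factor p n)
  have ndvd: "\<not> p dvd d" if "coprime d (p * n)" for d
    using that \<open>prime p\<close> coprime_common_divisor[of d "p * n" p] not_prime_unit[of p] by auto
  have p: "odd p"
    using factor.prems by simp
  have IH: "\<exists>x y. [a * x\<^sup>2 + b * y\<^sup>2 = c] (mod n)"
    using factor by simp
  show ?case
  proof (cases "p dvd n")
    case True
    then show ?thesis
      using ex_ax2_by2_cong_lift[OF \<open>prime p\<close> p _ _ _ _ IH] ndvd factor.prems by blast
  next
    case False
    then have "coprime p n"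
      using \<open>prime p\<close> by (simp add: prime_imp_coprime)
    then show ?thesis
      using ex_ax2_by2_cong_prime[OF \<open>prime p\<close> p ndvd ndvd] factor.prems(2,3) IH ex_ax2_by2_cong_coprime by blast
  qed
qed simp

section \<open>Quaternions over residue class rings\<close>

declare ring_iso_trans [trans]

lemma residue_class_hom: "residue_class n \<in> ring_hom \<Z> (ZFact (int n))"
  using ideal.rcos_ring_hom[OF int.genideal_ideal[of "{int n}"]]
  by (simp add: residue_class_def[abs_def] ZFact_def)

lemma residue_class_eq_iff: "residue_class n x = residue_class n y \<longleftrightarrow> [x = y] (mod int n)"
  by (auto simp: residue_class_eq cong_def)

lemma residue_class_simps:
  "residue_class n (x * y) = residue_class n x \<otimes>\<^bsub>ZFact (int n)\<^esub> residue_class n y"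
  "residue_class n (x + y) = residue_class n x \<oplus>\<^bsub>ZFact (int n)\<^esub> residue_class n y"
  "residue_class n (x - y) = residue_class n x \<ominus>\<^bsub>ZFact (int n)\<^esub> residue_class n y"
  "residue_class n 1 = \<one>\<^bsub>ZFact (int n)\<^esub>"
proof -
  interpret R: cring "ZFact (int n)"
    by (rule ZFact_is_cring)
  note hom = residue_class_hom[of n]
  show mult: "residue_class n (x * y) = residue_class n x \<otimes>\<^bsub>ZFact (int n)\<^esub> residue_class n y"
    using ring_hom_mult[OF hom, of x y] by simp
  have add: "residue_class n (x + y) = residue_class n x \<oplus>\<^bsub>ZFact (int n)\<^esub> residue_class n y" for x y
    using ring_hom_add[OF hom, of x y] by simp
  then show "residue_class n (x + y) = residue_class n x \<oplus>\<^bsub>ZFact (int n)\<^esub> residue_class n y" .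
  show "residue_class n 1 = \<one>\<^bsub>ZFact (int n)\<^esub>"
    using ring_hom_one[OF hom] by simp
  have "residue_class n x = residue_class n (x - y) \<oplus>\<^bsub>ZFact (int n)\<^esub> residue_class n y"
    by (simp flip: add)
  then show "residue_class n (x - y) = residue_class n x \<ominus>\<^bsub>ZFact (int n)\<^esub> residue_class n y"
    by (simp add: a_minus_def R.a_assoc R.r_neg residue_class_closed)
qed

lemma residue_class_Units:
  assumes "coprime x (int n)"
  shows "residue_class n x \<in> Units (ZFact (int n))"
proof -
  interpret R: cring "ZFact (int n)"
    by (rule ZFact_is_cring)
  obtain y where "[x * y = 1] (mod int n)"
    using cong_solve_coprime_int[OF assms] by blast
  then have "residue_class n x \<otimes>\<^bsub>ZFact (int n)\<^esub> residue_class n y = \<one>\<^bsub>ZFact (int n)\<^esub>"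
    by (simp add: residue_class_eq_iff flip: residue_class_simps)
  moreover from this have "residue_class n y \<otimes>\<^bsub>ZFact (int n)\<^esub> residue_class n x = \<one>\<^bsub>ZFact (int n)\<^esub>"
    by (simp add: R.m_comm residue_class_closed)
  ultimately show ?thesis
    unfolding Units_def using residue_class_closed by blast
qed

lemma quaternion_mod_cong:
  assumes "[a = a'] (mod int n)" "[b = b'] (mod int n)"
  shows "quaternion_mod n a b = quaternion_mod n a' b'"
  using assms by (simp add: quaternion_mod_def flip: residue_class_eq_iff)

lemma quaternion_mod_ring: "ring (quaternion_mod n a b)"
  unfolding quaternion_mod_def
  by (intro cring.quaternion_ring_is_ring ZFact_is_cring residue_class_closed)

lemma quaternion_mod_swap: "quaternion_mod n a b \<simeq> quaternion_mod n b a"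
  unfolding quaternion_mod_def
  by (intro cring.quaternion_ring_swap ZFact_is_cring residue_class_closed)

lemma quaternion_mod_norm:
  assumes "coprime (x\<^sup>2 - a * y\<^sup>2) (int n)" and "[c = (x\<^sup>2 - a * y\<^sup>2) * b] (mod int n)"
  shows "quaternion_mod n a b \<simeq> quaternion_mod n a c"
proof -
  have "quaternion_mod n a ((x\<^sup>2 - a * y\<^sup>2) * b) \<simeq> quaternion_mod n a b"
    using cring.quaternion_ring_norm[OF ZFact_is_cring, of "residue_class n a" "int n"
        "residue_class n b" "residue_class n x" "residue_class n y"]
      residue_class_Units[OF assms(1)]
    by (simp add: quaternion_mod_def residue_class_closed residue_class_simps power2_eq_square)
  moreover have "quaternion_mod n a ((x\<^sup>2 - a * y\<^sup>2) * b) = quaternion_mod n a c"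
    by (intro quaternion_mod_cong cong_refl cong_sym[OF assms(2)])
  ultimately show ?thesis
    using ring_iso_sym[OF quaternion_mod_ring] by metis
qed

text \<open>
  A unit represented by the quadratic form \<open>a x\<^sup>2 + b y\<^sup>2\<close> can be taken as the first parameter:
  \<open>x i + y j\<close> squares to \<open>c\<close> and anticommutes with \<open>k\<close>, and \<open>k\<close> squares to \<open>-a b\<close>. The proof
  reduces this to norms via
  \<open>(a, b) \<cong> (a, -a b) \<cong> (-a b, a) \<cong> (-a b, c) \<cong> (c, -a b)\<close>.
\<close>

lemma quaternion_mod_represent:
  assumes "coprime a (int n)" "coprime c (int n)" and c: "[a * x\<^sup>2 + b * y\<^sup>2 = c] (mod int n)"
  shows "quaternion_mod n a b \<simeq> quaternion_mod n c (- (a * b))"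
proof -
  obtain a' where a': "[a * a' = 1] (mod int n)"
    using cong_solve_coprime_int[OF assms(1)] by blast
  \<comment> \<open>The norm of \<open>x + (y / a) k\<close> when \<open>k\<^sup>2 = -a b\<close>; it equals \<open>c / a\<close>.\<close>
  define v where "v = x\<^sup>2 - (- (a * b)) * (a' * y)\<^sup>2"
  have "v * a = a * x\<^sup>2 + (a * a')\<^sup>2 * (b * y\<^sup>2)"
    by (simp add: v_def power2_eq_square algebra_simps)
  also have "[\<dots> = a * x\<^sup>2 + 1\<^sup>2 * (b * y\<^sup>2)] (mod int n)"
    by (intro cong_add cong_mult cong_pow a' cong_refl)
  also have "[a * x\<^sup>2 + 1\<^sup>2 * (b * y\<^sup>2) = c] (mod int n)"
    using c by simp
  finally have va: "[c = v * a] (mod int n)"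
    by (rule cong_sym)
  then have "coprime v (int n)"
    using assms(2) by (metis cong_imp_coprime coprime_mult_left_iff)
  have "quaternion_mod n a b \<simeq> quaternion_mod n a (- (a * b))"
    by (rule quaternion_mod_norm[of 0 _ 1]) (use assms in simp_all)
  also have "\<dots> \<simeq> quaternion_mod n (- (a * b)) a"
    by (rule quaternion_mod_swap)
  also have "\<dots> \<simeq> quaternion_mod n (- (a * b)) c"
    using \<open>coprime v (int n)\<close> va unfolding v_def by (rule quaternion_mod_norm)
  also have "\<dots> \<simeq> quaternion_mod n c (- (a * b))"
    by (rule quaternion_mod_swap)
  finally show ?thesis .
qed

lemma quaternion_mod_odd:
  assumes "odd n" "coprime a (int n)" "coprime b (int n)"
  shows "quaternion_mod n a b \<simeq> mat2_mod n"
proof -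
  obtain x y where "[a * x\<^sup>2 + b * y\<^sup>2 = 1] (mod int n)"
    using ex_ax2_by2_cong_odd[of "int n" a b 1] assms by auto
  then have "quaternion_mod n a b \<simeq> quaternion_mod n 1 (- (a * b))"
    using assms by (intro quaternion_mod_represent) auto
  also have "\<dots> \<simeq> mat2_mod n"
  proof -
    have "residue_class n 2 \<in> Units (ZFact (int n))"
      using \<open>odd n\<close> by (intro residue_class_Units) simp
    moreover have "residue_class n 2 = \<one>\<^bsub>ZFact (int n)\<^esub> \<oplus>\<^bsub>ZFact (int n)\<^esub> \<one>\<^bsub>ZFact (int n)\<^esub>"
      by (simp flip: residue_class_simps)
    moreover have "residue_class n (- (a * b)) \<in> Units (ZFact (int n))"
      using assms by (intro residue_class_Units) simp
    ultimately show ?thesis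
      unfolding quaternion_mod_def mat2_mod_def
      by (simp add: residue_class_simps(4) cring.quaternion_ring_split ZFact_is_cring)
  qed
  finally show ?thesis .
qed

lemma quaternion_mod_power_2_split:
  assumes "[a = 1] (mod 4)" "odd b"
  shows "quaternion_mod (2 ^ s) a b \<simeq> quaternion_mod (2 ^ s) 1 1"
proof -
  have "odd a"
    using assms(1) cong_dvd_modulus[of a 1 4 2] by (simp add: cong_def odd_iff_mod_2_eq_one)
  then obtain x y where "[a * x\<^sup>2 + b * y\<^sup>2 = 1] (mod 2 ^ s)"
    using ex_ax2_by2_cong_power_2[OF _ assms(2) cong_sym[OF assms(1)]] by blast
  then have "quaternion_mod (2 ^ s) a b \<simeq> quaternion_mod (2 ^ s) 1 (- (a * b))"
    using \<open>odd a\<close> by (intro quaternion_mod_represent) auto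
  also have "\<dots> \<simeq> quaternion_mod (2 ^ s) 1 1"
  proof -
    have "odd (- (a * b))"
      using \<open>odd a\<close> \<open>odd b\<close> by simp
    then obtain k where k: "- (a * b) = 2 * k + 1" ..
    \<comment> \<open>Every odd integer is a difference of two squares, that is, a norm for \<open>i\<^sup>2 = 1\<close>.\<close>
    have "quaternion_mod (2 ^ s) 1 1 \<simeq> quaternion_mod (2 ^ s) 1 (- (a * b))"
      unfolding k
      by (rule quaternion_mod_norm[of "k + 1" _ k])
        (simp_all add: power2_eq_square algebra_simps)
    then show ?thesis
      by (rule ring_iso_sym[OF quaternion_mod_ring])
  qed
  finally show ?thesis .
qed

lemma quaternion_mod_power_2_nonsplit:
  assumes "[a = -1] (mod 4)" "[b = -1] (mod 4)"
  shows "quaternion_mod (2 ^ s) a b \<simeq> quaternion_mod (2 ^ s) (-1) (-1)"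
proof -
  have odd: "odd a" "odd b"
    using assms[THEN cong_dvd_modulus, of 2] by (simp_all add: cong_def odd_iff_mod_2_eq_one)
  then obtain x y where "[a * x\<^sup>2 + b * y\<^sup>2 = -1] (mod 2 ^ s)"
    using ex_ax2_by2_cong_power_2[OF _ _ cong_sym[OF assms(1)]] by blast
  then have "quaternion_mod (2 ^ s) a b \<simeq> quaternion_mod (2 ^ s) (-1) (- (a * b))"
    using odd by (intro quaternion_mod_represent) auto
  also have "\<dots> \<simeq> quaternion_mod (2 ^ s) (-1) (-1)"
  proof -
    \<comment> \<open>\<open>a b\<close> is congruent to \<open>1\<close> modulo \<open>4\<close>, hence a sum of two squares modulo \<open>2\<^sup>s\<close>,
      that is, a norm for \<open>i\<^sup>2 = -1\<close>.\<close>
    have "[a * b = (-1) * (-1)] (mod 4)"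
      by (intro cong_mult assms)
    then obtain u v where "[1 * u\<^sup>2 + 1 * v\<^sup>2 = a * b] (mod 2 ^ s)"
      using ex_ax2_by2_cong_power_2[of 1 1 "a * b" s] by auto
    then have uv: "[a * b = u\<^sup>2 + v\<^sup>2] (mod int (2 ^ s))"
      by (simp add: cong_sym)
    moreover have "coprime (a * b) (int (2 ^ s))"
      using odd by simp
    ultimately have "coprime (u\<^sup>2 + v\<^sup>2) (int (2 ^ s))"
      by (rule cong_imp_coprime)
    moreover have "[- (a * b) = - (u\<^sup>2 + v\<^sup>2)] (mod int (2 ^ s))"
      using uv by (simp only: cong_minus_minus_iff)
    ultimately have "quaternion_mod (2 ^ s) (-1) (-1) \<simeq> quaternion_mod (2 ^ s) (-1) (- (a * b))"
      by (intro quaternion_mod_norm[of u _ v]) simp_all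
    then show ?thesis
      by (rule ring_iso_sym[OF quaternion_mod_ring])
  qed
  finally show ?thesis .
qed

section \<open>The Chinese remainder theorem\<close>

text \<open>
  The image of each residue class is recorded, because the parameters \<open>a\<close> and \<open>b\<close> of a
  quaternion ring have to be followed through the isomorphism.
\<close>

lemma ZFact_chinese_remainder:
  assumes "coprime m n"
  shows "\<exists>h \<in> ring_iso (ZFact (int (m * n))) (RDirProd (ZFact (int m)) (ZFact (int n))).
    \<forall>x. h (residue_class (m * n) x) = (residue_class m x, residue_class n x)"
proof -
  let ?I = "\<lambda>n. Idl\<^bsub>\<Z>\<^esub> {int n}"
  let ?h = "\<lambda>x. (?I m +>\<^bsub>\<Z>\<^esub> x, ?I n +>\<^bsub>\<Z>\<^esub> x)"
  have ideal: "ideal (?I n) \<Z>" for n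
    by (rule int.genideal_ideal) simp
  have mem: "x \<in> ?I k \<longleftrightarrow> int k dvd x" for x k
    by (auto simp: int_Idl dvd_def mult.commute)
  have inter: "?I m \<inter> ?I n = ?I (m * n)"
  proof (rule Set.set_eqI)
    fix x
    have "int m dvd x \<and> int n dvd x \<longleftrightarrow> int m * int n dvd x"
      using assms by (auto intro: divides_mult dest: dvd_mult_left dvd_mult_right)
    then show "x \<in> ?I m \<inter> ?I n \<longleftrightarrow> x \<in> ?I (m * n)"
      unfolding Int_iff mem unfolding of_nat_mult .
  qed
  obtain u v where uv: "u * int m + v * int n = 1"
    using assms bezout_int[of "int m" "int n"] by (auto simp: coprime_iff_gcd_eq_1)
  have sum: "?I m <+>\<^bsub>\<Z>\<^esub> ?I n = carrier \<Z>"
  proof -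
    have "x \<in> ?I m <+>\<^bsub>\<Z>\<^esub> ?I n" for x
    proof -
      have "x * u * int m + x * v * int n \<in> (\<Union>h\<in>?I m. \<Union>k\<in>?I n. {h + k})"
        by (intro UN_I[of "x * u * int m"] UN_I[of "x * v * int n"])
          (simp_all only: mem dvd_triv_right singleton_iff)
      also have "x * u * int m + x * v * int n = x * (u * int m + v * int n)"
        by (simp only: distrib_left mult.assoc)
      also have "\<dots> = x"
        by (simp add: uv)
      finally show ?thesis
        by (simp add: set_add_def')
    qed
    then show ?thesis
      by auto
  qed
  note hom = ring.canonical_proj_ring_hom[OF int.ring_axioms ideal ideal, of m n]
  note ker = ring.canonical_proj_ker[OF int.ring_axioms ideal ideal, of m n, unfolded inter]
  have iso: "(\<lambda>X. the_elem (?h ` X)) \<in> ring_iso (ZFact (int (m * n))) (RDirProd (ZFact (int m)) (ZFact (int n)))"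
    using ring_hom_ring.FactRing_iso_set[OF hom ring.canonical_proj_is_surj[OF int.ring_axioms ideal ideal sum]]
    unfolding ker ZFact_def .
  have val: "the_elem (?h ` residue_class (m * n) x) = (residue_class m x, residue_class n x)" for x
    using ring_hom_ring.the_elem_simp[OF hom int_Zcarr, of x] unfolding ker residue_class_def .
  show ?thesis
    by (rule bexI[OF _ iso]) (intro allI val)
qed

lemma quaternion_mod_chinese_remainder:
  assumes "coprime m n"
  shows "quaternion_mod (m * n) a b \<simeq> RDirProd (quaternion_mod m a b) (quaternion_mod n a b)"
proof -
  obtain h where h: "h \<in> ring_iso (ZFact (int (m * n))) (RDirProd (ZFact (int m)) (ZFact (int n)))"
    and [simp]: "\<And>x. h (residue_class (m * n) x) = (residue_class m x, residue_class n x)"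
    using ZFact_chinese_remainder[OF assms] by blast
  have "quaternion_mod (m * n) a b
      \<simeq> quaternion_ring (RDirProd (ZFact (int m)) (ZFact (int n)))
          (residue_class m a, residue_class n a) (residue_class m b, residue_class n b)"
    using quaternion_ring_cong[OF ZFact_is_cring RDirProd_cring[OF ZFact_is_cring ZFact_is_cring] h
        residue_class_closed residue_class_closed, of a b]
    by (simp add: quaternion_mod_def)
  also have "\<dots> \<simeq> RDirProd (quaternion_mod m a b) (quaternion_mod n a b)"
    unfolding quaternion_mod_def
    by (intro quaternion_ring_RDirProd ZFact_is_cring residue_class_closed)
  finally show ?thesis .
qed

lemma RDirProd_is_ring_iso:
  assumes "R \<simeq> R'" "S \<simeq> S'"
  shows "RDirProd R S \<simeq> RDirProd R' S'"
proof -
  obtain f g where "f \<in> ring_iso R R'" "g \<in> ring_iso S S'"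
    using assms unfolding is_ring_iso_def by blast
  from RDirProd_iso6[OF this] show ?thesis
    unfolding is_ring_iso_def by blast
qed

section \<open>The classification\<close>

theorem theorem4:
  fixes n :: nat and a b :: int
  assumes "n > 0"
    and "gcd a (int n) = 1" and "gcd b (int n) = 1"
  shows "(odd n \<longrightarrow> quaternion_mod n a b \<simeq> mat2_mod n) \<and>
    (\<forall>s m :: nat. n = 2 ^ s * m \<and> s > 0 \<and> odd m \<longrightarrow>
      (if s = 1 \<or> ([a = -1] (mod 4) \<and> [b = -1] (mod 4))
       then quaternion_mod n a b \<simeq> RDirProd (mat2_mod m) (quaternion_mod (2 ^ s) (-1) (-1))
       else quaternion_mod n a b \<simeq> RDirProd (mat2_mod m) (quaternion_mod (2 ^ s) 1 1)))"
proof (intro conjI allI impI)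
  have coprime: "coprime a (int n)" "coprime b (int n)"
    using assms by (simp_all add: coprime_iff_gcd_eq_1)
  show "quaternion_mod n a b \<simeq> mat2_mod n" if "odd n"
    using that coprime by (rule quaternion_mod_odd)
  fix s m :: nat
  assume *: "n = 2 ^ s * m \<and> s > 0 \<and> odd m"
  then have n: "n = m * 2 ^ s" and "s > 0" "odd m"
    by simp_all
  have "coprime a (int m)" "coprime b (int m)" and odd: "odd a" "odd b"
    using coprime \<open>s > 0\<close> by (simp_all add: n)
  then have m: "quaternion_mod m a b \<simeq> mat2_mod m"
    using \<open>odd m\<close> by (intro quaternion_mod_odd)
  have "coprime m (2 ^ s)"
    using \<open>odd m\<close> by simp
  have crt: "quaternion_mod n a b \<simeq> RDirProd (mat2_mod m) Q" if "quaternion_mod (2 ^ s) a b \<simeq> Q"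
    for Q :: "(int set \<times> int set \<times> int set \<times> int set) ring"
    unfolding n
    by (rule ring_iso_trans[OF quaternion_mod_chinese_remainder[OF \<open>coprime m (2 ^ s)\<close>]
          RDirProd_is_ring_iso[OF m that]])
  show "if s = 1 \<or> ([a = -1] (mod 4) \<and> [b = -1] (mod 4))
       then quaternion_mod n a b \<simeq> RDirProd (mat2_mod m) (quaternion_mod (2 ^ s) (-1) (-1))
       else quaternion_mod n a b \<simeq> RDirProd (mat2_mod m) (quaternion_mod (2 ^ s) 1 1)"
  proof (cases "s = 1")
    case True
    \<comment> \<open>All odd parameters agree modulo \<open>2\<close>.\<close>
    have "quaternion_mod (2 ^ s) a b = quaternion_mod (2 ^ s) (-1) (-1)"
      using odd True by (intro quaternion_mod_cong) (auto simp: cong_iff_dvd_diff)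
    then have "quaternion_mod (2 ^ s) a b \<simeq> quaternion_mod (2 ^ s) (-1) (-1)"
      by (simp add: ring_iso_refl)
    from crt[OF this] True show ?thesis
      by simp
  next
    case False
    have mod4: "[c = 1] (mod 4) \<or> [c = -1] (mod 4)" if "odd c" for c :: int
    proof -
      obtain k where k: "c = 2 * k + 1"
        using \<open>odd c\<close> ..
      show ?thesis
        by (cases "even k") (auto simp: k cong_iff_dvd_diff elim!: evenE oddE)
    qed
    show ?thesis
    proof (cases "[a = -1] (mod 4) \<and> [b = -1] (mod 4)")
      case True
      then have "quaternion_mod (2 ^ s) a b \<simeq> quaternion_mod (2 ^ s) (-1) (-1)"
        by (intro quaternion_mod_power_2_nonsplit) simp_all
      from crt[OF this] True show ?thesis
        by simp
    next
      case nonsplit: False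
      have "quaternion_mod (2 ^ s) a b \<simeq> quaternion_mod (2 ^ s) 1 1"
      proof (cases "[a = 1] (mod 4)")
        case True
        then show ?thesis
          using odd by (intro quaternion_mod_power_2_split)
      next
        case False
        then have "[b = 1] (mod 4)"
          using mod4 odd nonsplit by blast
        then have "quaternion_mod (2 ^ s) b a \<simeq> quaternion_mod (2 ^ s) 1 1"
          using odd by (intro quaternion_mod_power_2_split)
        with quaternion_mod_swap show ?thesis
          by (rule ring_iso_trans)
      qed
      from crt[OF this] nonsplit \<open>s \<noteq> 1\<close> show ?thesis
        by auto
    qed
  qed
qed

end
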